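(* Let $d\in\mathbb N$, $d\ge1$, $\mathsf Q=4d+2$, and let $K_r,\ \widetilde K_r,\ \vec K_r,\ \vec K^{\mathrm{pi}}_r$ be the kinetic kernels defined in the context. There exists a constant $C>0$ (depending only on $d$ and the fixed function $\psi$) such that for all $r>0$, $$\operatorname{supp}K_r\cup\operatorname{supp}\widetilde K_r\cup\operatorname{supp}\vec K^{\mathrm{pi}}_r\cup\operatorname{supp}\vec K_r\subset B^{\mathrm{kin}}_{Cr},$$ and, everywhere on $\mathbb R^{1+2d}$, $$|K_r|+|\vec K^{\mathrm{pi}}_r|+|\vec K_r|\le C r^{-\mathsf Q},\qquad |\widetilde K_r|\le C r^{-\mathsf Q+1},$$ $$|\nabla_yK_r|+|\nabla_y\vec K^{\mathrm{pi}}_r|+|\nabla_y\vec K_r|\le C r^{-\mathsf Q-3},\qquad |\nabla_y\widetilde K_r|\le C r^{-\mathsf Q-2}.$$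
   Context: Points of $\mathbb R^{1+2d}$ are written $(s,y,w)$ with $s\in\mathbb R$, $y,w\in\mathbb R^d$; $\nabla_y$ is differentiation in the variable $y$. For $r>0$, $B_r^{\mathrm{kin}}=\{(s,y,w)\in\mathbb R^{1+2d}:|s|<r^2,\ |y|<r^3,\ |w|<r\}$. Fix a nonnegative $\psi\in C_c^\infty(\mathbb R^{1+2d})$, $\psi=\psi(m_0,m_1,m_2)$ with $m_0\in\mathbb R$, $m_1,m_2\in\mathbb R^d$, with $\int\psi=1$ and $\operatorname{supp}\psi\subset(-2,-1)\times B_1(0)\times B_1(0)$. For $r>0$ let $g_1(r)=r^3\sin\log r$ and $g_2(r)=r^3\cos\log r$. For $a\in\mathbb R\setminus\{0\}$, $r>0$, let $$\mathcal A_a(r)=\begin{pmatrix} g_1(r) & a\,g_2(r)\\ a^{-1}\frac{\dot g_1(r)}{2r} & \frac{\dot g_2(r)}{2r}\end{pmatrix},\qquad \mathcal F_a(r)=\begin{pmatrix}\frac1a\,\partial_r\frac{\dot g_1(r)}{2r} & \partial_r\frac{\dot g_2(r)}{2r}\end{pmatrix},$$ where every scalar entry is understood as a multiple of the identity of $\mathbb R^d$, so $\mathcal A_a(r)$ acts on $\mathbb R^{2d}$ (and is invertible) and $\mathcal F_a(r)$ maps $\mathbb R^{2d}$ to $\mathbb R^d$. Write $(\mathcal A_a(r)^{-1})_{i;2}$, $i=1,2$, for the scalar entries of the second column of $\mathcal A_a(r)^{-1}$. For $r>0$, with $a=s/r^2$ and $b=\mathcal A_{a}(r)^{-1}\binom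 yw\in\mathbb R^{2d}$, define $$K_r(s,y,w)=2^dr^{-\mathsf Q}\psi(a,b),\qquad \widetilde K_r(s,y,w)=-2^{d+1}s\,r^{-\mathsf Q-1}\psi(a,b),$$ $$\vec K_r(s,y,w)=-2^dr^{-\mathsf Q}\psi(a,b)\,\mathcal F_a(r)b,\qquad \vec K^{\mathrm{pi}}_r(s,y,w)=2^{d+1}s\,r^{-\mathsf Q-1}\sum_{i=1}^2(\mathcal A_a(r)^{-1})_{i;2}\,[\nabla_{m_i}\psi](a,b).$$ All these kernels are understood to be $0$ when $s/r^2\notin(-2,-1)$. The first two are real-valued, the last two $\mathbb R^d$-valued. *)

theory Defs
  imports "HOL-Analysis.Analysis"
begin

text \<open>
  Points \<open>(s, y, w)\<close> of \<open>\<real>\<^sup>1\<^sup>+\<^sup>2\<^sup>d\<close> have type \<^typ>\<open>real \<times> (real^'d) \<times> (real^'d)\<close>, with \<open>d = CARD('d)\<close>.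
\<close>

primrec times_cont_diff :: "nat \<Rightarrow> ('a::real_normed_vector \<Rightarrow> 'b::real_normed_vector) \<Rightarrow> bool" where
  "times_cont_diff 0 f \<longleftrightarrow> continuous_on UNIV f"
| "times_cont_diff (Suc k) f \<longleftrightarrow>
     (\<forall>x. f differentiable (at x)) \<and>
     (\<forall>v. times_cont_diff k (\<lambda>x. frechet_derivative f (at x) v))"

definition smooth :: "('a::real_normed_vector \<Rightarrow> 'b::real_normed_vector) \<Rightarrow> bool" where
  "smooth f \<longleftrightarrow> (\<forall>k. times_cont_diff k f)"

definition supp :: "('a::topological_space \<Rightarrow> 'b::zero) \<Rightarrow> 'a set" where
  "supp f = closure {x. f x \<noteq> 0}"

text \<open>
  The vector of partial derivatives. For \<open>'b = real\<close> this is the gradient; for \<open>'b = real^'d\<close>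
  it is the transposed Jacobian matrix, and \<^const>\<open>norm\<close> on \<^typ>\<open>(real^'d)^'d\<close> is the
  Frobenius norm. It is meaningful only where \<open>f\<close> is differentiable.
\<close>
definition grad :: "(real^'d \<Rightarrow> 'b::real_normed_vector) \<Rightarrow> real^'d \<Rightarrow> 'b^'d" where
  "grad f x = (\<chi> j. frechet_derivative f (at x) (axis j 1))"

definition kin_ball :: "real \<Rightarrow> (real \<times> (real^'d) \<times> (real^'d)) set" where
  "kin_ball r = {(s, y, w). \<bar>s\<bar> < r ^ 2 \<and> norm y < r ^ 3 \<and> norm w < r}"

definition g1 :: "real \<Rightarrow> real" where
  "g1 r = r ^ 3 * sin (ln r)"

definition g2 :: "real \<Rightarrow> real" where
  "g2 r = r ^ 3 * cos (ln r)"

text \<open>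
  The matrices are stored through their scalar entries; \<open>blk_mult\<close> lets them act on
  \<open>\<real>\<^sup>2\<^sup>d = \<real>\<^sup>d \<times> \<real>\<^sup>d\<close>, each entry acting as a multiple of the identity of \<open>\<real>\<^sup>d\<close>.
\<close>
definition matA :: "real \<Rightarrow> real \<Rightarrow> real^2^2" where
  "matA a r = vector [vector [g1 r, a * g2 r],
                      vector [inverse a * (deriv g1 r / (2 * r)), deriv g2 r / (2 * r)]]"

definition rowF :: "real \<Rightarrow> real \<Rightarrow> real^2" where
  "rowF a r = vector [1 / a * deriv (\<lambda>\<rho>. deriv g1 \<rho> / (2 * \<rho>)) r,
                      deriv (\<lambda>\<rho>. deriv g2 \<rho> / (2 * \<rho>)) r]"

definition row_mult :: "real^2 \<Rightarrow> 'v::real_vector \<times> 'v \<Rightarrow> 'v" where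
  "row_mult R b = (R $ 1) *\<^sub>R fst b + (R $ 2) *\<^sub>R snd b"

definition blk_mult :: "real^2^2 \<Rightarrow> 'v::real_vector \<times> 'v \<Rightarrow> 'v \<times> 'v" where
  "blk_mult M b = (row_mult (M $ 1) b, row_mult (M $ 2) b)"

definition kinQ :: "'d::finite itself \<Rightarrow> int" where
  "kinQ _ = 4 * int CARD('d) + 2"

definition grad_m1 :: "(real \<times> (real^'d) \<times> (real^'d) \<Rightarrow> real) \<Rightarrow>
    real \<times> (real^'d) \<times> (real^'d) \<Rightarrow> real^'d" where
  "grad_m1 \<psi> = (\<lambda>(m0, m1, m2). grad (\<lambda>m. \<psi> (m0, m, m2)) m1)"

definition grad_m2 :: "(real \<times> (real^'d) \<times> (real^'d) \<Rightarrow> real) \<Rightarrow>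
    real \<times> (real^'d) \<times> (real^'d) \<Rightarrow> real^'d" where
  "grad_m2 \<psi> = (\<lambda>(m0, m1, m2). grad (\<lambda>m. \<psi> (m0, m1, m)) m2)"

definition ker :: "(real \<times> (real^'d) \<times> (real^'d) \<Rightarrow> real) \<Rightarrow> real \<Rightarrow>
    real \<times> (real^'d) \<times> (real^'d) \<Rightarrow> real" where
  "ker \<psi> r = (\<lambda>(s, y, w).
     let a = s / r ^ 2; b = blk_mult (matrix_inv (matA a r)) (y, w)
     in if a \<in> {-2<..<-1}
        then 2 ^ CARD('d) * r powi (- kinQ TYPE('d)) * \<psi> (a, b)
        else 0)"

definition ker_tilde :: "(real \<times> (real^'d) \<times> (real^'d) \<Rightarrow> real) \<Rightarrow> real \<Rightarrow>
    real \<times> (real^'d) \<times> (real^'d) \<Rightarrow> real" where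
  "ker_tilde \<psi> r = (\<lambda>(s, y, w).
     let a = s / r ^ 2; b = blk_mult (matrix_inv (matA a r)) (y, w)
     in if a \<in> {-2<..<-1}
        then - (2 ^ (CARD('d) + 1)) * s * r powi (- kinQ TYPE('d) - 1) * \<psi> (a, b)
        else 0)"

definition ker_vec :: "(real \<times> (real^'d) \<times> (real^'d) \<Rightarrow> real) \<Rightarrow> real \<Rightarrow>
    real \<times> (real^'d) \<times> (real^'d) \<Rightarrow> real^'d" where
  "ker_vec \<psi> r = (\<lambda>(s, y, w).
     let a = s / r ^ 2; b = blk_mult (matrix_inv (matA a r)) (y, w)
     in if a \<in> {-2<..<-1}
        then (- (2 ^ CARD('d)) * r powi (- kinQ TYPE('d)) * \<psi> (a, b)) *\<^sub>R row_mult (rowF a r) b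
        else 0)"

definition ker_pi :: "(real \<times> (real^'d) \<times> (real^'d) \<Rightarrow> real) \<Rightarrow> real \<Rightarrow>
    real \<times> (real^'d) \<times> (real^'d) \<Rightarrow> real^'d" where
  "ker_pi \<psi> r = (\<lambda>(s, y, w).
     let a = s / r ^ 2; b = blk_mult (matrix_inv (matA a r)) (y, w)
     in if a \<in> {-2<..<-1}
        then (2 ^ (CARD('d) + 1) * s * r powi (- kinQ TYPE('d) - 1)) *\<^sub>R
               ((matrix_inv (matA a r) $ 1 $ 2) *\<^sub>R grad_m1 \<psi> (a, b)
              + (matrix_inv (matA a r) $ 2 $ 2) *\<^sub>R grad_m2 \<psi> (a, b))
        else 0)"

text \<open>
  The block action of \<^term>\<open>matrix_inv (matA a r)\<close> inverts that of \<^term>\<open>matA a r\<close>.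
\<close>

lemma deriv_g1: "r > 0 \<Longrightarrow> deriv g1 r = r ^ 2 * (3 * sin (ln r) + cos (ln r))"
  unfolding g1_def
  by (rule DERIV_imp_deriv) (auto intro!: derivative_eq_intros simp: field_simps power2_eq_square power3_eq_cube)

lemma deriv_g2: "r > 0 \<Longrightarrow> deriv g2 r = r ^ 2 * (3 * cos (ln r) - sin (ln r))"
  unfolding g2_def
  by (rule DERIV_imp_deriv) (auto intro!: derivative_eq_intros simp: field_simps power2_eq_square power3_eq_cube)

lemma det_matA:
  assumes "a \<noteq> 0" "r > 0"
  shows "det (matA a r) = - (r ^ 4) / 2"
proof -
  have e: "deriv g1 r / (2 * r) = r * (3 * sin (ln r) + cos (ln r)) / 2"
      "deriv g2 r / (2 * r) = r * (3 * cos (ln r) - sin (ln r)) / 2"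
    using assms(2) by (simp_all add: deriv_g1 deriv_g2 power2_eq_square)
  have alg: "(r ^ 3 * S) * (r * (3 * C - S) / 2) - (a * (r ^ 3 * C)) * (inverse a * (r * (3 * S + C) / 2))
      = - (r ^ 4 * (S * S + C * C)) / 2" for S C
  proof -
    have "(a * (r ^ 3 * C)) * (inverse a * (r * (3 * S + C) / 2)) = (r ^ 3 * C) * (r * (3 * S + C) / 2)"
      using assms(1) by simp
    then show ?thesis
      by (simp only:) (simp add: field_simps power3_eq_cube power4_eq_xxxx)
  qed
  have "det (matA a r) = - (r ^ 4 * (sin (ln r) * sin (ln r) + cos (ln r) * cos (ln r))) / 2"
    unfolding matA_def e det_2 vector_2 g1_def g2_def alg ..
  also have "sin (ln r) * sin (ln r) + cos (ln r) * cos (ln r) = 1"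
    using sin_cos_squared_add[of "ln r"] by (simp add: power2_eq_square)
  finally show ?thesis by simp
qed

lemma blk_mult_assoc: "blk_mult M (blk_mult N b) = blk_mult (M ** N) b"
  by (simp add: blk_mult_def row_mult_def matrix_matrix_mult_def sum_2 algebra_simps)

lemma blk_mult_one: "blk_mult (mat 1) b = b"
  by (simp add: blk_mult_def row_mult_def mat_def)

lemma blk_mult_matA_inverse:
  assumes "a \<noteq> 0" "r > 0"
  shows "blk_mult (matA a r) (blk_mult (matrix_inv (matA a r)) b) = b"
    and "blk_mult (matrix_inv (matA a r)) (blk_mult (matA a r) b) = b"
proof -
  have "invertible (matA a r)"
    using det_matA[OF assms] assms by (simp add: invertible_det_nz)
  then have "matA a r ** matrix_inv (matA a r) = mat 1 \<and> matrix_inv (matA a r) ** matA a r = mat 1"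
    unfolding invertible_def matrix_inv_def by (rule someI_ex)
  then show "blk_mult (matA a r) (blk_mult (matrix_inv (matA a r)) b) = b"
    and "blk_mult (matrix_inv (matA a r)) (blk_mult (matA a r) b) = b"
    by (simp_all add: blk_mult_assoc blk_mult_one)
qed

end

theory Submission
  imports Defs
begin

text \<open>
  For fixed \<open>s\<close> and \<open>w\<close>, every kernel vanishes identically in \<open>y\<close> or is, as a function of \<open>y\<close>, a linear combination of functions
  \<open>y \<mapsto> \<Phi> (a, A\<inverse>(y, w))\<close> with \<open>a = s / r\<^sup>2\<close>, where the profile \<open>\<Phi>\<close> is one of \<open>\<psi>\<close>, \<open>\<psi> m\<^sub>1\<close>, \<open>\<psi> m\<^sub>2\<close>,
  \<open>\<nabla>\<^bsub>m1\<^esub>\<psi>\<close>, \<open>\<nabla>\<^bsub>m2\<^esub>\<psi>\<close>. None of these depends on \<open>r\<close>, and each is continuously differentiable and vanishes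
  off the compact support of \<open>\<psi>\<close>; hence all of them, together with their derivatives, obey one
  common bound (\<open>C1_supported_bounded\<close>).

  All dependence on \<open>r\<close> therefore sits in the coefficients, which are explicit. As
  \<open>det A = - r\<^sup>4 / 2\<close> does not degenerate, the first column of \<open>A\<inverse>\<close> is of order \<open>r\<^sup>-\<^sup>3\<close> and
  the second of order \<open>r\<^sup>-\<^sup>1\<close> (\<open>matrix_inv_matA\<close>), while the row \<open>F\<close> is of order \<open>1\<close>
  (\<open>rowF_entries\<close>), all uniformly for \<open>a \<in> (-2, -1)\<close>; the trigonometric functions of \<open>ln r\<close>
  only enter through their boundedness. Each \<open>y\<close>-derivative falls on the first column of
  \<open>A\<inverse>\<close> and thus costs \<open>r\<^sup>-\<^sup>3\<close>. In \<^const>\<open>ker_pi\<close> the extra factor \<open>s r\<^sup>-\<^sup>1\<close>, of order \<open>r\<close>, is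
  compensated by the second column of \<open>A\<inverse>\<close>; in \<^const>\<open>ker_tilde\<close> it survives and gives the
  exponents that are larger by one. The bookkeeping is done by the predicate
  \<open>C1_bound\<close>, which is stable under sums and scalar multiples.

  For the supports, a kernel can be nonzero at \<open>(s, y, w)\<close> only if \<open>(y, w) = A b\<close> with \<open>b\<close> in a
  product of unit balls, and the rows of \<open>A\<close> are of order \<open>r\<^sup>3\<close> and \<open>r\<close>.
\<close>

section \<open>Functions with a scaled bound on values and derivative\<close>

text \<open>
  \<open>X\<close> bounds the size and \<open>t\<close> is the cost of one derivative: \<open>t = 1\<close> for a fixed profile,
  \<open>t = r\<^sup>-\<^sup>3\<close> for a kernel in its variable \<open>y\<close>. Since both bounds are proportional to \<open>X\<close>,
  sums and scalar multiples act on \<open>X\<close> alone.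
\<close>
definition C1_bound ::
    "real \<Rightarrow> real \<Rightarrow> ('a::real_normed_vector \<Rightarrow> 'b::real_normed_vector) \<Rightarrow> bool" where
  "C1_bound t X f \<longleftrightarrow> (\<forall>y. norm (f y) \<le> X \<and>
     (\<exists>D. (f has_derivative D) (at y) \<and> (\<forall>h. norm (D h) \<le> X * t * norm h)))"

lemma C1_bound_mono:
  assumes "C1_bound t X f" "X \<le> Y" "t \<ge> 0"
  shows "C1_bound t Y f"
  unfolding C1_bound_def
proof (intro allI conjI)
  fix y
  obtain D where D: "(f has_derivative D) (at y)" "\<And>h. norm (D h) \<le> X * t * norm h"
    and n: "norm (f y) \<le> X"
    using assms(1) unfolding C1_bound_def by blast
  show "norm (f y) \<le> Y"
    using n assms(2) by (rule order_trans)
  have "norm (D h) \<le> Y * t * norm h" for h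
    by (rule order_trans[OF D(2)]) (intro mult_right_mono assms norm_ge_zero)
  with D(1) show "\<exists>D. (f has_derivative D) (at y) \<and> (\<forall>h. norm (D h) \<le> Y * t * norm h)"
    by blast
qed

lemma C1_bound_zero: "t \<ge> 0 \<Longrightarrow> X \<ge> 0 \<Longrightarrow> C1_bound t X (\<lambda>_. 0)"
  unfolding C1_bound_def by (auto intro!: exI[of _ "\<lambda>_. 0"])

lemma C1_bound_add:
  assumes "C1_bound t X f" "C1_bound t Y g"
  shows "C1_bound t (X + Y) (\<lambda>y. f y + g y)"
  unfolding C1_bound_def
proof (intro allI conjI)
  fix y
  obtain D E where D: "(f has_derivative D) (at y)" "\<And>h. norm (D h) \<le> X * t * norm h"
    and E: "(g has_derivative E) (at y)" "\<And>h. norm (E h) \<le> Y * t * norm h"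
    and n: "norm (f y) \<le> X" "norm (g y) \<le> Y"
    using assms unfolding C1_bound_def by blast
  show "norm (f y + g y) \<le> X + Y"
    using n by (rule norm_triangle_mono)
  have "norm (D h + E h) \<le> (X + Y) * t * norm h" for h
    using norm_triangle_mono[OF D(2)[of h] E(2)[of h]] by (simp add: distrib_right)
  then show "\<exists>D. ((\<lambda>y. f y + g y) has_derivative D) (at y) \<and> (\<forall>h. norm (D h) \<le> (X + Y) * t * norm h)"
    using has_derivative_add[OF D(1) E(1)] by blast
qed

lemma C1_bound_scaleR:
  assumes "C1_bound t X f" "\<bar>k\<bar> \<le> c"
  shows "C1_bound t (c * X) (\<lambda>y. k *\<^sub>R f y)"
  unfolding C1_bound_def
proof (intro allI conjI)
  fix y
  obtain D where D: "(f has_derivative D) (at y)" "\<And>h. norm (D h) \<le> X * t * norm h"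
    and n: "norm (f y) \<le> X"
    using assms(1) unfolding C1_bound_def by blast
  have "norm (k *\<^sub>R f y) = \<bar>k\<bar> * norm (f y)"
    by simp
  also have "\<dots> \<le> c * X"
    using n assms(2) by (intro mult_mono) auto
  finally show "norm (k *\<^sub>R f y) \<le> c * X" .
  have "norm (k *\<^sub>R D h) \<le> c * X * t * norm h" for h
  proof -
    have "norm (k *\<^sub>R D h) = \<bar>k\<bar> * norm (D h)"
      by simp
    also have "\<dots> \<le> c * (X * t * norm h)"
      using D(2)[of h] assms(2) by (intro mult_mono) auto
    finally show ?thesis by (simp add: mult.assoc)
  qed
  then show "\<exists>D. ((\<lambda>y. k *\<^sub>R f y) has_derivative D) (at y) \<and> (\<forall>h. norm (D h) \<le> c * X * t * norm h)"
    using has_derivative_scaleR_right[OF D(1), of k] by blast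
qed

text \<open>
  The factor \<open>CARD('d)\<close> passes from the operator norm of the derivative to the norm of the vector
  of its \<open>d\<close> partial derivatives.
\<close>
lemma C1_bound_imp_grad:
  fixes f :: "real^'d \<Rightarrow> 'b::real_normed_vector"
  assumes "C1_bound t X f"
  shows "norm (f y) \<le> X" "f differentiable (at y)" "norm (grad f y) \<le> real CARD('d) * (X * t)"
proof -
  obtain D where D: "(f has_derivative D) (at y)" "\<And>h. norm (D h) \<le> X * t * norm h"
    using assms unfolding C1_bound_def by blast
  show "norm (f y) \<le> X"
    using assms unfolding C1_bound_def by blast
  show "f differentiable (at y)"
    using D(1) by (rule differentiableI)
  have "grad f y = (\<chi> j. D (axis j 1))"
    unfolding grad_def using frechet_derivative_at[OF D(1)] by simp
  also have "norm \<dots> \<le> (\<Sum>j\<in>(UNIV::'d set). norm (D (axis j 1)))"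
    unfolding norm_vec_def by (rule order_trans[OF L2_set_le_sum]) auto
  also have "\<dots> \<le> (\<Sum>j\<in>(UNIV::'d set). X * t)"
    by (intro sum_mono order_trans[OF D(2)]) (simp add: norm_axis_1)
  finally show "norm (grad f y) \<le> real CARD('d) * (X * t)"
    by simp
qed

section \<open>Compactly supported profiles\<close>

text \<open>
  The derivative is required to be continuous only along each fixed direction, which is how
  \<^const>\<open>times_cont_diff\<close> expresses continuity; in finite dimension this suffices.
\<close>
definition C1_supported_in ::
    "'a set \<Rightarrow> ('a::euclidean_space \<Rightarrow> 'b::real_normed_vector) \<Rightarrow> bool" where
  "C1_supported_in K \<Phi> \<longleftrightarrow> (\<forall>x. x \<notin> K \<longrightarrow> \<Phi> x = 0) \<and>
     (\<exists>\<Phi>'. (\<forall>x. (\<Phi> has_derivative \<Phi>' x) (at x)) \<and> (\<forall>v. continuous_on UNIV (\<lambda>x. \<Phi>' x v)))"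

lemma has_derivative_zero_off_support:
  assumes "closed K" "\<And>x. x \<notin> K \<Longrightarrow> \<Phi> x = 0" "(\<Phi> has_derivative D) (at x)" "x \<notin> K"
  shows "D = (\<lambda>_. 0)"
proof -
  have "(\<Phi> has_derivative (\<lambda>_. 0)) (at x)"
    by (rule has_derivative_transform_within_open[of "\<lambda>_. 0" _ x UNIV "- K"])
       (use assms in \<open>auto simp: open_Compl\<close>)
  then show ?thesis
    using assms(3) has_derivative_unique by blast
qed

text \<open>
  Off \<open>K\<close> the function and its derivative vanish; on \<open>K\<close> the function and its finitely many
  partial derivatives are bounded by compactness.
\<close>
lemma C1_supported_bounded:
  assumes "compact K" "C1_supported_in K \<Phi>"
  shows "\<exists>B\<ge>0. C1_bound 1 B \<Phi>"
proof -
  obtain \<Phi>' where D: "\<And>x. (\<Phi> has_derivative \<Phi>' x) (at x)"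
    and cont: "\<And>v. continuous_on UNIV (\<lambda>x. \<Phi>' x v)" and z: "\<And>x. x \<notin> K \<Longrightarrow> \<Phi> x = 0"
    using assms(2) unfolding C1_supported_in_def by blast
  have bdd: "\<exists>B\<ge>0. \<forall>x. norm (f x) \<le> B"
    if "continuous_on UNIV f" "\<And>x. x \<notin> K \<Longrightarrow> f x = 0" for f :: "'a \<Rightarrow> 'b"
  proof -
    have "bounded (f ` K)"
      by (intro compact_imp_bounded compact_continuous_image assms(1)
            continuous_on_subset[OF that(1)]) simp
    then obtain B where "B > 0" "\<forall>x\<in>K. norm (f x) \<le> B"
      unfolding bounded_pos by auto
    with that(2) have "norm (f x) \<le> B" for x
      by (cases "x \<in> K") auto
    with \<open>B > 0\<close> show ?thesis by (intro exI[of _ B]) simp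
  qed
  have "continuous_on UNIV \<Phi>"
    by (rule has_derivative_continuous_on) (use D in simp)
  from bdd[OF this z] obtain B0 where B0: "B0 \<ge> 0" "\<And>x. norm (\<Phi> x) \<le> B0" by blast
  have "\<Phi>' x = (\<lambda>_. 0)" if "x \<notin> K" for x
    using assms(1) z D that by (rule has_derivative_zero_off_support[OF compact_imp_closed])
  then have "\<exists>B\<ge>0. \<forall>x. norm (\<Phi>' x i) \<le> B" for i
    by (intro bdd[OF cont]) simp
  then obtain B1 where B1: "\<And>i. B1 i \<ge> 0" "\<And>i x. norm (\<Phi>' x i) \<le> B1 i" by metis
  define B where "B = B0 + (\<Sum>i\<in>Basis. B1 i)"
  have S0: "0 \<le> (\<Sum>i\<in>Basis. B1 i)"
    by (intro sum_nonneg B1)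
  have "norm (\<Phi>' x v) \<le> B * norm v" for x v
  proof -
    interpret bounded_linear "\<Phi>' x" using D by (rule has_derivative_bounded_linear)
    have "\<Phi>' x v = \<Phi>' x (\<Sum>i\<in>Basis. (v \<bullet> i) *\<^sub>R i)" by (simp add: euclidean_representation)
    also have "\<dots> = (\<Sum>i\<in>Basis. (v \<bullet> i) *\<^sub>R \<Phi>' x i)" by (simp add: sum scaleR)
    also have "norm \<dots> \<le> (\<Sum>i\<in>Basis. norm v * B1 i)"
      by (intro sum_norm_le) (auto intro!: mult_mono Basis_le_norm B1)
    also have "\<dots> = (\<Sum>i\<in>Basis. B1 i) * norm v"
      by (simp add: sum_distrib_left mult.commute)
    also have "\<dots> \<le> B * norm v"
      using B0(1) by (intro mult_right_mono) (auto simp: B_def)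
    finally show ?thesis .
  qed
  moreover have "norm (\<Phi> x) \<le> B" for x
    using B0(2)[of x] S0 by (simp add: B_def)
  moreover have "B \<ge> 0"
    using B0(1) S0 by (simp add: B_def)
  ultimately show ?thesis
    using D unfolding C1_bound_def mult_1_right by blast
qed

lemma times_cont_diff_Suc_0_C1:
  assumes "times_cont_diff (Suc 0) \<Phi>" "\<And>x. x \<notin> K \<Longrightarrow> \<Phi> x = 0"
  shows "C1_supported_in K \<Phi>"
  unfolding C1_supported_in_def
proof (intro conjI allI impI exI)
  show "(\<Phi> has_derivative frechet_derivative \<Phi> (at x)) (at x)" for x
    using assms(1) unfolding times_cont_diff.simps frechet_derivative_works by blast
  show "continuous_on UNIV (\<lambda>x. frechet_derivative \<Phi> (at x) v)" for v
    using assms(1) unfolding times_cont_diff.simps by blast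
qed (rule assms(2))

lemma C1_supported_scaleR_linear:
  fixes \<psi> :: "'a::euclidean_space \<Rightarrow> real"
  assumes "C1_supported_in K \<psi>" "bounded_linear L"
  shows "C1_supported_in K (\<lambda>x. \<psi> x *\<^sub>R L x)"
proof -
  obtain D where D: "\<And>x. (\<psi> has_derivative D x) (at x)"
    and cont: "\<And>v. continuous_on UNIV (\<lambda>x. D x v)" and z: "\<And>x. x \<notin> K \<Longrightarrow> \<psi> x = 0"
    using assms(1) unfolding C1_supported_in_def by blast
  have "continuous_on UNIV \<psi>"
    by (rule has_derivative_continuous_on) (use D in simp)
  moreover have "continuous_on UNIV L"
    using assms(2) by (rule linear_continuous_on)
  ultimately have "continuous_on UNIV (\<lambda>x. \<psi> x *\<^sub>R L v + D x v *\<^sub>R L x)" for v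
    by (intro continuous_intros cont)
  moreover have "((\<lambda>x. \<psi> x *\<^sub>R L x) has_derivative (\<lambda>v. \<psi> x *\<^sub>R L v + D x v *\<^sub>R L x)) (at x)" for x
    by (intro has_derivative_scaleR D bounded_linear_imp_has_derivative assms)
  ultimately show ?thesis
    using z unfolding C1_supported_in_def
    by (intro conjI exI[of _ "\<lambda>x v. \<psi> x *\<^sub>R L v + D x v *\<^sub>R L x"]) auto
qed

lemma C1_supported_vec:
  fixes \<Phi> :: "'n::finite \<Rightarrow> 'a::euclidean_space \<Rightarrow> real"
  assumes "\<And>j. C1_supported_in K (\<Phi> j)"
  shows "C1_supported_in K (\<lambda>x. \<chi> j. \<Phi> j x)"
proof -
  obtain D where D: "\<And>j x. (\<Phi> j has_derivative D j x) (at x)"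
    and cont: "\<And>j v. continuous_on UNIV (\<lambda>x. D j x v)"
    using assms unfolding C1_supported_in_def by metis
  have "((\<lambda>x. \<chi> j. \<Phi> j x) has_derivative (\<lambda>v. \<chi> j. D j x v)) (at x)" for x
    by (subst has_derivative_componentwise_within)
       (auto simp: Basis_vec_def inner_axis intro: D)
  moreover have "continuous_on UNIV (\<lambda>x. \<chi> j. D j x v)" for v
    by (intro continuous_on_vec_lambda cont)
  moreover have "(\<chi> j. \<Phi> j x) = 0" if "x \<notin> K" for x
    using assms that unfolding C1_supported_in_def by (simp add: vec_eq_iff)
  ultimately show ?thesis
    unfolding C1_supported_in_def by (intro conjI exI[of _ "\<lambda>x v. \<chi> j. D j x v"]) auto
qed

text \<open>
  The partial gradients \<^const>\<open>grad_m1\<close> and \<^const>\<open>grad_m2\<close> are directional derivatives of the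
  full function, to which \<^const>\<open>times_cont_diff\<close> applies.
\<close>
lemma grad_m1_eq:
  assumes "\<psi> differentiable (at x)"
  shows "grad_m1 \<psi> x = (\<chi> j. frechet_derivative \<psi> (at x) (0, axis j 1, 0))"
proof -
  obtain m0 m1 m2 where x: "x = (m0, m1, m2)" by (metis prod.collapse)
  have "((\<lambda>m. \<psi> (m0, m, m2)) has_derivative (\<lambda>h. frechet_derivative \<psi> (at x) (0, h, 0))) (at m1)"
  proof (rule has_derivative_compose[where g = \<psi> and f = "\<lambda>m. (m0, m, m2)"])
    show "((\<lambda>m. (m0, m, m2)) has_derivative (\<lambda>h. (0, h, 0))) (at m1)"
      by (intro has_derivative_Pair has_derivative_const has_derivative_ident)
    show "(\<psi> has_derivative frechet_derivative \<psi> (at x)) (at (m0, m1, m2))"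
      using assms unfolding x frechet_derivative_works .
  qed
  from frechet_derivative_at[OF this] show ?thesis
    unfolding x grad_m1_def grad_def by (simp add: fun_eq_iff x)
qed

lemma grad_m2_eq:
  assumes "\<psi> differentiable (at x)"
  shows "grad_m2 \<psi> x = (\<chi> j. frechet_derivative \<psi> (at x) (0, 0, axis j 1))"
proof -
  obtain m0 m1 m2 where x: "x = (m0, m1, m2)" by (metis prod.collapse)
  have "((\<lambda>m. \<psi> (m0, m1, m)) has_derivative (\<lambda>h. frechet_derivative \<psi> (at x) (0, 0, h))) (at m2)"
  proof (rule has_derivative_compose[where g = \<psi> and f = "\<lambda>m. (m0, m1, m)"])
    show "((\<lambda>m. (m0, m1, m)) has_derivative (\<lambda>h. (0, 0, h))) (at m2)"
      by (intro has_derivative_Pair has_derivative_const has_derivative_ident)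
    show "(\<psi> has_derivative frechet_derivative \<psi> (at x)) (at (m0, m1, m2))"
      using assms unfolding x frechet_derivative_works .
  qed
  from frechet_derivative_at[OF this] show ?thesis
    unfolding x grad_m2_def grad_def by (simp add: fun_eq_iff x)
qed

lemma zero_off_supp: "x \<notin> supp f \<Longrightarrow> f x = 0"
  using closure_subset[of "{x. f x \<noteq> 0}"] by (auto simp: supp_def)

lemma smooth_C1:
  assumes "smooth \<psi>"
  shows "C1_supported_in (supp \<psi>) \<psi>"
proof (rule times_cont_diff_Suc_0_C1)
  show "times_cont_diff (Suc 0) \<psi>"
    using assms unfolding smooth_def by (rule spec)
qed (rule zero_off_supp)

lemma smooth_directional_derivative_C1:
  assumes "smooth \<psi>"
  shows "C1_supported_in (supp \<psi>) (\<lambda>x. frechet_derivative \<psi> (at x) v)"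
proof (rule times_cont_diff_Suc_0_C1)
  have "times_cont_diff (Suc (Suc 0)) \<psi>"
    using assms unfolding smooth_def by blast
  then have t2: "(\<forall>x. \<psi> differentiable (at x)) \<and>
      (\<forall>v. times_cont_diff (Suc 0) (\<lambda>x. frechet_derivative \<psi> (at x) v))"
    by (rule times_cont_diff.simps(2)[THEN iffD1])
  show "times_cont_diff (Suc 0) (\<lambda>x. frechet_derivative \<psi> (at x) v)"
    by (rule t2[THEN conjunct2, THEN spec])
  show "frechet_derivative \<psi> (at x) v = 0" if "x \<notin> supp \<psi>" for x
  proof -
    have "closed (supp \<psi>)"
      by (simp add: supp_def)
    moreover have "(\<psi> has_derivative frechet_derivative \<psi> (at x)) (at x)"
      using t2[THEN conjunct1, THEN spec] by (rule frechet_derivative_works[THEN iffD1])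
    ultimately have "frechet_derivative \<psi> (at x) = (\<lambda>_. 0)"
      using has_derivative_zero_off_support[where K = "supp \<psi>" and \<Phi> = \<psi>] zero_off_supp[where f = \<psi>] that
      by blast
    then show ?thesis by simp
  qed
qed

lemma smooth_grad_C1:
  fixes \<psi> :: "real \<times> (real^'d) \<times> (real^'d) \<Rightarrow> real"
  assumes "smooth \<psi>"
  shows "C1_supported_in (supp \<psi>) (grad_m1 \<psi>)" "C1_supported_in (supp \<psi>) (grad_m2 \<psi>)"
proof -
  have "times_cont_diff (Suc 0) \<psi>"
    using assms unfolding smooth_def by blast
  then have diff: "\<And>x. \<psi> differentiable (at x)"
    unfolding times_cont_diff.simps(2) by blast
  have "grad_m1 \<psi> = (\<lambda>x. \<chi> j. frechet_derivative \<psi> (at x) (0, axis j 1, 0))"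
    "grad_m2 \<psi> = (\<lambda>x. \<chi> j. frechet_derivative \<psi> (at x) (0, 0, axis j 1))"
    using diff by (auto simp: fun_eq_iff grad_m1_eq grad_m2_eq)
  then show "C1_supported_in (supp \<psi>) (grad_m1 \<psi>)" "C1_supported_in (supp \<psi>) (grad_m2 \<psi>)"
    using assms by (auto intro!: C1_supported_vec smooth_directional_derivative_C1)
qed

section \<open>Size of the matrices and of their inverses\<close>

lemma deriv_g1_div: "r > 0 \<Longrightarrow> deriv g1 r / (2 * r) = r * (3 * sin (ln r) + cos (ln r)) / 2"
  by (simp add: deriv_g1 power2_eq_square)

lemma deriv_g2_div: "r > 0 \<Longrightarrow> deriv g2 r / (2 * r) = r * (3 * cos (ln r) - sin (ln r)) / 2"
  by (simp add: deriv_g2 power2_eq_square)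

lemma matrix_inv_unique_left:
  fixes A N :: "'a::field^'n^'n"
  assumes "N ** A = mat 1"
  shows "matrix_inv A = N"
proof -
  have "\<exists>N. A ** N = mat 1 \<and> N ** A = mat 1"
    using assms matrix_left_right_inverse[of N A] by blast
  then have inv: "A ** matrix_inv A = mat 1 \<and> matrix_inv A ** A = mat 1"
    unfolding matrix_inv_def by (rule someI_ex)
  have "matrix_inv A = (N ** A) ** matrix_inv A"
    by (simp only: assms matrix_mul_lid)
  also have "\<dots> = N ** (A ** matrix_inv A)"
    by (rule matrix_mul_assoc[symmetric])
  also have "\<dots> = N"
    by (simp only: inv matrix_mul_rid)
  finally show ?thesis .
qed

text \<open>
  Both diagonal entries of the product with \<^const>\<open>matA\<close> collapse to \<open>sin\<^sup>2 + cos\<^sup>2\<close>, so the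
  inverse has no denominator that depends on the phase \<open>ln r\<close>.
\<close>
lemma matrix_inv_matA:
  assumes "a \<noteq> 0" "r > 0"
  shows "matrix_inv (matA a r) $ 1 $ 1 = (sin (ln r) - 3 * cos (ln r)) / r ^ 3"
    and "matrix_inv (matA a r) $ 1 $ 2 = 2 * a * cos (ln r) / r"
    and "matrix_inv (matA a r) $ 2 $ 1 = (3 * sin (ln r) + cos (ln r)) / (a * r ^ 3)"
    and "matrix_inv (matA a r) $ 2 $ 2 = - 2 * sin (ln r) / r"
proof -
  define S C where "S = sin (ln r)" and "C = cos (ln r)"
  have SC: "S * S + C * C = 1"
    using sin_cos_squared_add[of "ln r"] by (simp add: S_def C_def power2_eq_square)
  define N :: "real^2^2" where "N = vector [vector [(S - 3 * C) / r ^ 3, 2 * a * C / r],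
    vector [(3 * S + C) / (a * r ^ 3), - 2 * S / r]]"
  have A: "matA a r = vector [vector [r ^ 3 * S, a * (r ^ 3 * C)],
      vector [inverse a * (r * (3 * S + C) / 2), r * (3 * C - S) / 2]]"
    using assms(2) by (simp only: matA_def deriv_g1_div deriv_g2_div g1_def g2_def S_def C_def)
  have e: "(S - 3 * C) / r ^ 3 * (r ^ 3 * S) + 2 * a * C / r * (inverse a * (r * (3 * S + C) / 2)) = S * S + C * C"
    "(S - 3 * C) / r ^ 3 * (a * (r ^ 3 * C)) + 2 * a * C / r * (r * (3 * C - S) / 2) = 0"
    "(3 * S + C) / (a * r ^ 3) * (r ^ 3 * S) + - 2 * S / r * (inverse a * (r * (3 * S + C) / 2)) = 0"
    "(3 * S + C) / (a * r ^ 3) * (a * (r ^ 3 * C)) + - 2 * S / r * (r * (3 * C - S) / 2) = S * S + C * C"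
    using assms by (simp_all add: field_simps)
  have "N ** matA a r = mat 1"
    unfolding A N_def
    by (simp only: vec_eq_iff forall_2 matrix_matrix_mult_def vec_lambda_beta sum_2 vector_2 e SC)
       (simp add: mat_def)
  then have "matrix_inv (matA a r) = N"
    by (rule matrix_inv_unique_left)
  then show "matrix_inv (matA a r) $ 1 $ 1 = (sin (ln r) - 3 * cos (ln r)) / r ^ 3"
    and "matrix_inv (matA a r) $ 1 $ 2 = 2 * a * cos (ln r) / r"
    and "matrix_inv (matA a r) $ 2 $ 1 = (3 * sin (ln r) + cos (ln r)) / (a * r ^ 3)"
    and "matrix_inv (matA a r) $ 2 $ 2 = - 2 * sin (ln r) / r"
    by (simp_all add: N_def S_def C_def)
qed

lemma rowF_entries:
  assumes "r > 0"
  shows "rowF a r $ 1 = (sin (ln r) + 2 * cos (ln r)) / a"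
    and "rowF a r $ 2 = cos (ln r) - 2 * sin (ln r)"
proof -
  have "((\<lambda>\<rho>. deriv g1 \<rho> / (2 * \<rho>)) has_real_derivative sin (ln r) + 2 * cos (ln r)) (at r)"
  proof (rule has_field_derivative_transform_within_open[where S = "{0<..}"])
    show "((\<lambda>\<rho>. \<rho> * (3 * sin (ln \<rho>) + cos (ln \<rho>)) / 2) has_real_derivative
        sin (ln r) + 2 * cos (ln r)) (at r)"
      using assms by (auto intro!: derivative_eq_intros simp: field_simps)
  qed (use assms deriv_g1_div in auto)
  then show "rowF a r $ 1 = (sin (ln r) + 2 * cos (ln r)) / a"
    by (simp add: rowF_def DERIV_imp_deriv)
  have "((\<lambda>\<rho>. deriv g2 \<rho> / (2 * \<rho>)) has_real_derivative cos (ln r) - 2 * sin (ln r)) (at r)"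
  proof (rule has_field_derivative_transform_within_open[where S = "{0<..}"])
    show "((\<lambda>\<rho>. \<rho> * (3 * cos (ln \<rho>) - sin (ln \<rho>)) / 2) has_real_derivative
        cos (ln r) - 2 * sin (ln r)) (at r)"
      using assms by (auto intro!: derivative_eq_intros simp: field_simps)
  qed (use assms deriv_g2_div in auto)
  then show "rowF a r $ 2 = cos (ln r) - 2 * sin (ln r)"
    by (simp add: rowF_def DERIV_imp_deriv)
qed

lemma abs_trig_combination_le:
  fixes t :: real
  shows "\<bar>p * sin t + q * cos t\<bar> \<le> \<bar>p\<bar> + \<bar>q\<bar>"
proof -
  have "\<bar>p * sin t + q * cos t\<bar> \<le> \<bar>p\<bar> * \<bar>sin t\<bar> + \<bar>q\<bar> * \<bar>cos t\<bar>"
    using abs_triangle_ineq[of "p * sin t" "q * cos t"] by (simp add: abs_mult)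
  also have "\<dots> \<le> \<bar>p\<bar> * 1 + \<bar>q\<bar> * 1"
    by (intro add_mono mult_left_mono) auto
  finally show ?thesis by simp
qed

lemma abs_divide_le:
  fixes x :: real
  assumes "\<bar>x\<bar> \<le> c" "\<bar>a\<bar> \<ge> 1"
  shows "\<bar>x / a\<bar> \<le> c"
proof -
  have "\<bar>x\<bar> / \<bar>a\<bar> \<le> \<bar>x\<bar> / 1"
    using assms(2) by (intro divide_left_mono) auto
  with assms(1) show ?thesis by simp
qed

lemma matrix_inv_matA_bounds:
  assumes "a \<in> {-2<..<-1}" "r > 0"
  shows "\<bar>matrix_inv (matA a r) $ 1 $ 1\<bar> \<le> 4 / r ^ 3"
    and "\<bar>matrix_inv (matA a r) $ 1 $ 2\<bar> \<le> 4 / r"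
    and "\<bar>matrix_inv (matA a r) $ 2 $ 1\<bar> \<le> 4 / r ^ 3"
    and "\<bar>matrix_inv (matA a r) $ 2 $ 2\<bar> \<le> 4 / r"
proof -
  have a: "a \<noteq> 0" "\<bar>a\<bar> \<ge> 1" "\<bar>a\<bar> \<le> 2" using assms by auto
  note inv = matrix_inv_matA[OF a(1) assms(2)]
  have "\<bar>sin (ln r) - 3 * cos (ln r)\<bar> \<le> 4"
    using abs_trig_combination_le[of 1 "ln r" "-3"] by simp
  then show "\<bar>matrix_inv (matA a r) $ 1 $ 1\<bar> \<le> 4 / r ^ 3"
    using assms(2) unfolding inv by (simp add: abs_divide divide_right_mono)
  have "\<bar>a * cos (ln r)\<bar> \<le> 2 * 1"
    unfolding abs_mult using a by (intro mult_mono) auto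
  then show "\<bar>matrix_inv (matA a r) $ 1 $ 2\<bar> \<le> 4 / r"
    using assms(2) unfolding inv by (simp add: abs_divide abs_mult divide_right_mono)
  have "\<bar>(3 * sin (ln r) + cos (ln r)) / a\<bar> \<le> 4"
    using abs_trig_combination_le[of 3 "ln r" 1] a(2) by (intro abs_divide_le) simp_all
  then have "\<bar>(3 * sin (ln r) + cos (ln r)) / a\<bar> / r ^ 3 \<le> 4 / r ^ 3"
    using assms(2) by (intro divide_right_mono) auto
  then show "\<bar>matrix_inv (matA a r) $ 2 $ 1\<bar> \<le> 4 / r ^ 3"
    using assms(2) unfolding inv by (simp add: abs_divide abs_mult)
  have "2 * \<bar>sin (ln r)\<bar> \<le> 4"
    using abs_sin_le_one[of "ln r"] by linarith
  then show "\<bar>matrix_inv (matA a r) $ 2 $ 2\<bar> \<le> 4 / r"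
    using assms(2) unfolding inv by (simp add: abs_divide abs_mult divide_right_mono)
qed

lemma rowF_bounds:
  assumes "a \<in> {-2<..<-1}" "r > 0"
  shows "\<bar>rowF a r $ 1\<bar> \<le> 3" and "\<bar>rowF a r $ 2\<bar> \<le> 3"
proof -
  show "\<bar>rowF a r $ 1\<bar> \<le> 3"
    unfolding rowF_entries[OF assms(2)]
    by (rule abs_divide_le) (use assms abs_trig_combination_le[of 1 "ln r" 2] in auto)
  show "\<bar>rowF a r $ 2\<bar> \<le> 3"
    unfolding rowF_entries[OF assms(2)]
    using abs_trig_combination_le[of "-2" "ln r" 1] by simp
qed

lemma row_mult_norm_le:
  fixes b :: "'v::real_normed_vector \<times> 'v"
  assumes "\<bar>R $ 1\<bar> \<le> p" "\<bar>R $ 2\<bar> \<le> q" "norm (fst b) \<le> 1" "norm (snd b) \<le> 1"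
  shows "norm (row_mult R b) \<le> p + q"
proof -
  have "norm (row_mult R b) \<le> \<bar>R $ 1\<bar> * norm (fst b) + \<bar>R $ 2\<bar> * norm (snd b)"
    unfolding row_mult_def by (rule norm_triangle_le) simp
  also have "\<dots> \<le> p * 1 + q * 1"
    using assms by (intro add_mono mult_mono) auto
  finally show ?thesis by simp
qed

lemma matA_image_bounds:
  fixes b :: "'v::real_normed_vector \<times> 'v"
  assumes "a \<in> {-2<..<-1}" "r > 0" "norm (fst b) \<le> 1" "norm (snd b) \<le> 1"
  shows "norm (fst (blk_mult (matA a r) b)) \<le> 3 * r ^ 3"
    and "norm (snd (blk_mult (matA a r) b)) \<le> 4 * r"
proof -
  have r3: "\<bar>r ^ 3\<bar> = r ^ 3" "\<bar>a\<bar> \<le> 2"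
    using assms(1,2) by auto
  have "\<bar>g1 r\<bar> \<le> r ^ 3 * 1" "\<bar>g2 r\<bar> \<le> r ^ 3 * 1"
    unfolding g1_def g2_def abs_mult r3(1) using assms(2) by (intro mult_left_mono; simp)+
  moreover from this(2) have "\<bar>a * g2 r\<bar> \<le> 2 * (r ^ 3 * 1)"
    unfolding abs_mult using r3(2) by (intro mult_mono) auto
  ultimately have "norm (row_mult (matA a r $ 1) b) \<le> r ^ 3 + 2 * r ^ 3"
    by (intro row_mult_norm_le assms(3,4)) (simp_all only: matA_def vector_2 mult_1_right)
  then show "norm (fst (blk_mult (matA a r) b)) \<le> 3 * r ^ 3"
    by (simp add: blk_mult_def)
  have half: "\<bar>x * (r / 2)\<bar> \<le> 2 * r" if "\<bar>x\<bar> \<le> 4" for x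
    using mult_right_mono[OF that, of "r / 2"] assms(2) by (simp add: abs_mult)
  have "\<bar>(3 * sin (ln r) + cos (ln r)) / a\<bar> \<le> 4"
    using abs_trig_combination_le[of 3 "ln r" 1] assms(1) by (intro abs_divide_le) auto
  then have row1: "\<bar>(3 * sin (ln r) + cos (ln r)) / a * (r / 2)\<bar> \<le> 2 * r"
    by (rule half)
  have "\<bar>3 * cos (ln r) - sin (ln r)\<bar> \<le> 4"
    using abs_trig_combination_le[of "-1" "ln r" 3] by simp
  then have row2: "\<bar>(3 * cos (ln r) - sin (ln r)) * (r / 2)\<bar> \<le> 2 * r"
    by (rule half)
  have "matA a r $ 2 $ 1 = (3 * sin (ln r) + cos (ln r)) / a * (r / 2)"
    "matA a r $ 2 $ 2 = (3 * cos (ln r) - sin (ln r)) * (r / 2)"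
    unfolding matA_def vector_2 deriv_g1_div[OF assms(2)] deriv_g2_div[OF assms(2)]
    by (simp_all only: divide_inverse mult_ac)
  with row1 have "norm (row_mult (matA a r $ 2) b) \<le> 2 * r + 2 * r"
    using row2 by (intro row_mult_norm_le assms(3,4)) (simp_all only:)
  then show "norm (snd (blk_mult (matA a r) b)) \<le> 4 * r"
    by (simp add: blk_mult_def)
qed

section \<open>Rescaled profiles\<close>

text \<open>
  By the chain rule a variation \<open>h\<close> of \<open>y\<close> moves the argument of \<open>\<Phi>\<close> by the first column of the
  inverse matrix times \<open>h\<close>, a displacement of length at most \<open>8 r\<^sup>-\<^sup>3 \<bar>h\<bar>\<close>.
  The values are still bounded by \<open>B\<close>; this is weakened to \<open>8 B\<close> so that one constant serves both.
\<close>
lemma C1_bound_profile: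
  fixes \<Phi> :: "real \<times> (real^'d) \<times> (real^'d) \<Rightarrow> 'b::real_normed_vector"
  assumes "B \<ge> 0"
    and B: "C1_bound 1 B \<Phi>"
    and ar: "a \<in> {-2<..<-1}" "r > 0"
  shows "C1_bound (1 / r ^ 3) (8 * B) (\<lambda>y. \<Phi> (a, blk_mult (matrix_inv (matA a r)) (y, w)))"
  unfolding C1_bound_def
proof (intro allI conjI)
  fix y
  define M where "M = matrix_inv (matA a r)"
  note Mb = matrix_inv_matA_bounds[OF ar, folded M_def]
  have "norm (\<Phi> (a, blk_mult M (y, w))) \<le> B"
    using B unfolding C1_bound_def by blast
  then show "norm (\<Phi> (a, blk_mult (matrix_inv (matA a r)) (y, w))) \<le> 8 * B"
    using \<open>B \<ge> 0\<close> unfolding M_def by linarith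
  obtain D where D: "(\<Phi> has_derivative D) (at (a, blk_mult M (y, w)))" "\<And>v. norm (D v) \<le> B * norm v"
    using B unfolding C1_bound_def mult_1_right by blast
  have "((\<lambda>y. \<Phi> (a, blk_mult M (y, w))) has_derivative
      (\<lambda>h. D (0, (M $ 1 $ 1) *\<^sub>R h, (M $ 2 $ 1) *\<^sub>R h))) (at y)"
    by (rule has_derivative_compose[where g = \<Phi> and f = "\<lambda>y. (a, blk_mult M (y, w))", OF _ D(1)])
       (auto simp: blk_mult_def row_mult_def intro!: derivative_eq_intros)
  moreover have "norm (D (0, (M $ 1 $ 1) *\<^sub>R h, (M $ 2 $ 1) *\<^sub>R h)) \<le> 8 * B * (1 / r ^ 3) * norm h" for h
  proof -
    have "norm (0::real, (M $ 1 $ 1) *\<^sub>R h, (M $ 2 $ 1) *\<^sub>R h) \<le> norm ((M $ 1 $ 1) *\<^sub>R h) + norm ((M $ 2 $ 1) *\<^sub>R h)"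
      using norm_Pair_le[of "0::real" "((M $ 1 $ 1) *\<^sub>R h, (M $ 2 $ 1) *\<^sub>R h)"]
        norm_Pair_le[of "(M $ 1 $ 1) *\<^sub>R h" "(M $ 2 $ 1) *\<^sub>R h"] by simp
    also have "\<dots> \<le> 4 / r ^ 3 * norm h + 4 / r ^ 3 * norm h"
      unfolding norm_scaleR by (intro add_mono mult_right_mono Mb) auto
    finally have "B * norm (0::real, (M $ 1 $ 1) *\<^sub>R h, (M $ 2 $ 1) *\<^sub>R h) \<le> B * (4 / r ^ 3 * norm h + 4 / r ^ 3 * norm h)"
      using \<open>B \<ge> 0\<close> by (rule mult_left_mono)
    also have "\<dots> = 8 * B * (1 / r ^ 3) * norm h"
      by (simp add: field_simps)
    finally show ?thesis
      using D(2) order_trans by blast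
  qed
  ultimately show "\<exists>D. ((\<lambda>y. \<Phi> (a, blk_mult (matrix_inv (matA a r)) (y, w))) has_derivative D) (at y) \<and>
      (\<forall>h. norm (D h) \<le> 8 * B * (1 / r ^ 3) * norm h)"
    unfolding M_def by blast
qed

section \<open>Supports and bounds of the kernels\<close>

text \<open>
  The constraints are closed conditions, so they pass from the nonvanishing set of \<open>f\<close> to its
  closure; any \<open>C \<ge> 5\<close> then leaves room for the strict inequalities.
\<close>
lemma supp_subset_kin_ball:
  fixes f :: "real \<times> (real^'d) \<times> (real^'d) \<Rightarrow> 'b::zero"
  assumes nz: "\<And>s y w. f (s, y, w) \<noteq> 0 \<Longrightarrow> s / r ^ 2 \<in> {-2<..<-1} \<and>
      blk_mult (matrix_inv (matA (s / r ^ 2) r)) (y, w) \<in> ball 0 1 \<times> ball 0 1"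
    and "r > 0" "C \<ge> 5"
  shows "supp f \<subseteq> kin_ball (C * r)"
proof -
  let ?S = "{x :: real \<times> (real^'d) \<times> (real^'d).
    \<bar>fst x\<bar> \<le> 2 * r ^ 2 \<and> norm (fst (snd x)) \<le> 3 * r ^ 3 \<and> norm (snd (snd x)) \<le> 4 * r}"
  have "f x = 0 \<or> x \<in> ?S" for x
  proof (cases "f x = 0")
    case False
    obtain s y w where x: "x = (s, y, w)" by (metis prod.collapse)
    define b where "b = blk_mult (matrix_inv (matA (s / r ^ 2) r)) (y, w)"
    have a: "s / r ^ 2 \<in> {-2<..<-1}" and b: "norm (fst b) \<le> 1" "norm (snd b) \<le> 1"
      using nz[of s y w] False x by (auto simp: b_def mem_Times_iff less_imp_le)
    have "blk_mult (matA (s / r ^ 2) r) b = (y, w)"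
      unfolding b_def using a \<open>r > 0\<close> by (intro blk_mult_matA_inverse) auto
    with matA_image_bounds[OF a \<open>r > 0\<close> b] have "norm y \<le> 3 * r ^ 3" "norm w \<le> 4 * r"
      by simp_all
    moreover have "\<bar>s\<bar> \<le> 2 * r ^ 2"
      using a \<open>r > 0\<close> by (auto simp: field_simps abs_le_iff)
    ultimately show ?thesis using x by simp
  qed auto
  moreover have "closed ?S"
    by (intro closed_Collect_conj closed_Collect_le continuous_intros)
  ultimately have "supp f \<subseteq> ?S"
    unfolding supp_def by (intro closure_minimal) auto
  also have "?S \<subseteq> kin_ball (C * r)"
  proof -
    have "2 * r ^ 2 < (C * r) ^ 2" "3 * r ^ 3 < (C * r) ^ 3" "4 * r < C * r"
      using power_mono[OF \<open>C \<ge> 5\<close>, of 2] power_mono[OF \<open>C \<ge> 5\<close>, of 3] \<open>r > 0\<close> \<open>C \<ge> 5\<close>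
      by (auto simp: power_mult_distrib intro!: mult_strict_right_mono)
    then show ?thesis
      unfolding kin_ball_def by fastforce
  qed
  finally show ?thesis .
qed

lemma abs_time_le:
  fixes r s :: real
  assumes "s / r ^ 2 \<in> {-2<..<-1}" "r > 0" "q \<ge> 0" "k \<ge> 0"
  shows "\<bar>k * s * (q / r)\<bar> \<le> 2 * k * (q * r)"
proof -
  have "\<bar>s\<bar> \<le> 2 * r ^ 2"
    using assms by (auto simp: field_simps abs_le_iff)
  then have "k * \<bar>s\<bar> * (q / r) \<le> k * (2 * r ^ 2) * (q / r)"
    using assms by (intro mult_right_mono mult_left_mono) auto
  also have "\<dots> = 2 * k * (q * r)"
    using assms by (simp add: power2_eq_square)
  finally show ?thesis
    using assms by (simp add: abs_mult)
qed

text \<open>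
  Here \<open>B\<close> is the common bound of the five profiles and \<open>q = r\<^sup>-\<^sup>Q\<close>. Each profile contributes \<open>8 B\<close>.
  The entries of the row \<open>F\<close> are at most \<open>3\<close>, whence \<open>48 = (3 + 3) 8\<close>. The prefactor \<open>2 s r\<^sup>-\<^sup>1\<close>
  is at most \<open>4 r\<close>, whence \<open>32 = 4 \<cdot> 8\<close>; multiplied by the second column of the inverse matrix, with
  entries at most \<open>4 r\<^sup>-\<^sup>1\<close>, it gives \<open>256 = 4 (4 + 4) 8\<close>.
\<close>
lemma kernel_slice_bounds:
  fixes \<psi> :: "real \<times> (real^'d) \<times> (real^'d) \<Rightarrow> real"
    and B q r s :: real and w :: "real^'d"
  assumes "B \<ge> 0" "r > 0"
    and P: "C1_bound 1 B \<psi>" "C1_bound 1 B (\<lambda>x. \<psi> x *\<^sub>R fst (snd x))"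
      "C1_bound 1 B (\<lambda>x. \<psi> x *\<^sub>R snd (snd x))" "C1_bound 1 B (grad_m1 \<psi>)" "C1_bound 1 B (grad_m2 \<psi>)"
    and q: "q = r powi (- kinQ TYPE('d))"
  shows "C1_bound (1 / r ^ 3) (2 ^ CARD('d) * q * (8 * B)) (\<lambda>y. ker \<psi> r (s, y, w))"
    and "C1_bound (1 / r ^ 3) (2 ^ CARD('d) * q * (48 * B)) (\<lambda>y. ker_vec \<psi> r (s, y, w))"
    and "C1_bound (1 / r ^ 3) (2 ^ CARD('d) * q * (256 * B)) (\<lambda>y. ker_pi \<psi> r (s, y, w))"
    and "C1_bound (1 / r ^ 3) (2 ^ CARD('d) * (q * r) * (32 * B)) (\<lambda>y. ker_tilde \<psi> r (s, y, w))"
proof -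
  have "q > 0" using \<open>r > 0\<close> q by simp
  have q1: "r powi (- kinQ TYPE('d) - 1) = q / r"
    using \<open>r > 0\<close> by (simp add: q power_int_diff)
  define a where "a = s / r ^ 2"
  define M where "M = matrix_inv (matA a r)"
  let ?Z = "C1_bound (1 / r ^ 3)"
  let ?c = "2 ^ CARD('d) :: real"
  have "?Z (?c * q * (8 * B)) (\<lambda>y. ker \<psi> r (s, y, w)) \<and>
    ?Z (?c * q * (48 * B)) (\<lambda>y. ker_vec \<psi> r (s, y, w)) \<and>
    ?Z (?c * q * (256 * B)) (\<lambda>y. ker_pi \<psi> r (s, y, w)) \<and>
    ?Z (?c * (q * r) * (32 * B)) (\<lambda>y. ker_tilde \<psi> r (s, y, w))"
  proof (cases "a \<in> {-2<..<-1}")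
    case False
    then have F: "(s / r ^ 2 \<in> {-2<..<-1}) = False"
      by (simp add: a_def)
    have "ker \<psi> r (s, y, w) = 0 \<and> ker_tilde \<psi> r (s, y, w) = 0 \<and>
        ker_vec \<psi> r (s, y, w) = 0 \<and> ker_pi \<psi> r (s, y, w) = 0" for y
      unfolding ker_def ker_tilde_def ker_vec_def ker_pi_def Let_def prod.case F if_False by simp
    then show ?thesis
      using \<open>q > 0\<close> \<open>B \<ge> 0\<close> \<open>r > 0\<close> by (auto intro!: C1_bound_zero)
  next
    case True
    note Mb = matrix_inv_matA_bounds[OF True \<open>r > 0\<close>, folded M_def]
      and Fb = rowF_bounds[OF True \<open>r > 0\<close>]
      and prof = C1_bound_profile[OF \<open>B \<ge> 0\<close> _ True \<open>r > 0\<close>, folded M_def]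
    note scale = C1_bound_scaleR
    have "ker \<psi> r (s, y, w) = (?c * q) *\<^sub>R \<psi> (a, blk_mult M (y, w))" for y
      using True by (simp add: ker_def Let_def a_def M_def q)
    then have K1: "?Z (?c * q * (8 * B)) (\<lambda>y. ker \<psi> r (s, y, w))"
      using scale[OF prof[OF P(1)], of "?c * q" "?c * q"] \<open>q > 0\<close> by simp

    have "ker_tilde \<psi> r (s, y, w) = (- (2 * ?c * s * (q / r))) *\<^sub>R \<psi> (a, blk_mult M (y, w))" for y
      using True by (simp add: ker_tilde_def Let_def a_def M_def q1)
    moreover have coef: "\<bar>2 * ?c * s * (q / r)\<bar> \<le> 2 * (2 * ?c) * (q * r)"
      by (rule abs_time_le) (use True \<open>r > 0\<close> \<open>q > 0\<close> in \<open>auto simp: a_def\<close>)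
    ultimately have K2: "?Z (?c * (q * r) * (32 * B)) (\<lambda>y. ker_tilde \<psi> r (s, y, w))"
      using scale[OF prof[OF P(1)], of "- (2 * ?c * s * (q / r))" "2 * (2 * ?c) * (q * r)"]
      by (simp add: mult_ac)

    have "ker_vec \<psi> r (s, y, w) = (- (?c * q)) *\<^sub>R
        ((rowF a r $ 1) *\<^sub>R (\<psi> (a, blk_mult M (y, w)) *\<^sub>R fst (snd (a, blk_mult M (y, w)))) +
         (rowF a r $ 2) *\<^sub>R (\<psi> (a, blk_mult M (y, w)) *\<^sub>R snd (snd (a, blk_mult M (y, w)))))" for y
      using True
      by (simp add: ker_vec_def Let_def row_mult_def scaleR_add_right mult_ac flip: a_def M_def q)
    moreover have "?Z (?c * q * (3 * (8 * B) + 3 * (8 * B))) (\<lambda>y. (- (?c * q)) *\<^sub>R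
        ((rowF a r $ 1) *\<^sub>R (\<psi> (a, blk_mult M (y, w)) *\<^sub>R fst (snd (a, blk_mult M (y, w)))) +
         (rowF a r $ 2) *\<^sub>R (\<psi> (a, blk_mult M (y, w)) *\<^sub>R snd (snd (a, blk_mult M (y, w))))))"
      by (intro scale C1_bound_add Fb prof[OF P(2)] prof[OF P(3)]) (use \<open>q > 0\<close> in auto)
    ultimately have K3: "?Z (?c * q * (48 * B)) (\<lambda>y. ker_vec \<psi> r (s, y, w))"
      by simp

    have "ker_pi \<psi> r (s, y, w) = (2 * ?c * s * (q / r)) *\<^sub>R
        ((M $ 1 $ 2) *\<^sub>R grad_m1 \<psi> (a, blk_mult M (y, w)) +
         (M $ 2 $ 2) *\<^sub>R grad_m2 \<psi> (a, blk_mult M (y, w)))" for y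
      using True by (simp add: ker_pi_def Let_def a_def M_def q1)
    moreover have "?Z (2 * (2 * ?c) * (q * r) * (4 / r * (8 * B) + 4 / r * (8 * B)))
      (\<lambda>y. (2 * ?c * s * (q / r)) *\<^sub>R
        ((M $ 1 $ 2) *\<^sub>R grad_m1 \<psi> (a, blk_mult M (y, w)) +
         (M $ 2 $ 2) *\<^sub>R grad_m2 \<psi> (a, blk_mult M (y, w))))"
      by (intro scale C1_bound_add Mb prof[OF P(4)] prof[OF P(5)] coef)
    moreover have "2 * (2 * ?c) * (q * r) * (4 / r * (8 * B) + 4 / r * (8 * B)) = ?c * q * (256 * B)"
      using \<open>r > 0\<close> by (simp add: field_simps)
    ultimately have K4: "?Z (?c * q * (256 * B)) (\<lambda>y. ker_pi \<psi> r (s, y, w))"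
      by simp
    show ?thesis using K1 K2 K3 K4 by blast
  qed
  then show "?Z (?c * q * (8 * B)) (\<lambda>y. ker \<psi> r (s, y, w))"
    "?Z (?c * q * (48 * B)) (\<lambda>y. ker_vec \<psi> r (s, y, w))"
    "?Z (?c * q * (256 * B)) (\<lambda>y. ker_pi \<psi> r (s, y, w))"
    "?Z (?c * (q * r) * (32 * B)) (\<lambda>y. ker_tilde \<psi> r (s, y, w))"
    by blast+
qed

text \<open>
  Each kernel is a combination of profiles that vanish off \<open>supp \<psi>\<close>, which lies over a product
  of unit balls.
\<close>
lemma kernel_supports:
  fixes \<psi> :: "real \<times> (real^'d) \<times> (real^'d) \<Rightarrow> real"
  assumes "smooth \<psi>" "supp \<psi> \<subseteq> {-2<..<-1} \<times> ball 0 1 \<times> ball 0 1" "r > 0" "C \<ge> 5"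
  shows "supp (ker \<psi> r) \<union> supp (ker_tilde \<psi> r) \<union> supp (ker_pi \<psi> r) \<union> supp (ker_vec \<psi> r)
    \<subseteq> kin_ball (C * r)"
proof -
  have z: "\<psi> x = 0" "grad_m1 \<psi> x = 0" "grad_m2 \<psi> x = 0" if "x \<notin> supp \<psi>" for x
    using smooth_C1[OF assms(1)] smooth_grad_C1[OF assms(1)] that
    unfolding C1_supported_in_def by blast+
  have nz: "s / r ^ 2 \<in> {-2<..<-1} \<and>
      blk_mult (matrix_inv (matA (s / r ^ 2) r)) (y, w) \<in> ball 0 1 \<times> ball 0 1"
    if "ker \<psi> r (s, y, w) \<noteq> 0 \<or> ker_tilde \<psi> r (s, y, w) \<noteq> 0 \<or>
      ker_pi \<psi> r (s, y, w) \<noteq> 0 \<or> ker_vec \<psi> r (s, y, w) \<noteq> 0" for s y w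
  proof -
    let ?x = "(s / r ^ 2, blk_mult (matrix_inv (matA (s / r ^ 2) r)) (y, w))"
    have "?x \<in> supp \<psi>"
    proof (rule ccontr)
      assume "?x \<notin> supp \<psi>"
      from z[OF this] that show False
        by (simp add: ker_def ker_tilde_def ker_pi_def ker_vec_def Let_def split: if_splits)
    qed
    with assms(2) have "?x \<in> {-2<..<-1} \<times> ball 0 1 \<times> ball 0 1"
      by blast
    then show ?thesis
      by (simp only: mem_Sigma_iff)
  qed
  show ?thesis
    by (intro Un_least supp_subset_kin_ball[OF nz assms(3,4)]) simp_all
qed

theorem lemma2p3:
  fixes \<psi> :: "real \<times> (real^'d) \<times> (real^'d) \<Rightarrow> real"
  assumes "smooth \<psi>"
    and "compact (supp \<psi>)"
    and "\<And>m. \<psi> m \<ge> 0"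
    and "(\<integral>m. \<psi> m \<partial>lborel) = 1"
    and "supp \<psi> \<subseteq> {-2<..<-1} \<times> ball 0 1 \<times> ball 0 1"
  shows "\<exists>C>0. \<forall>r>0.
    supp (ker \<psi> r) \<union> supp (ker_tilde \<psi> r) \<union> supp (ker_pi \<psi> r) \<union> supp (ker_vec \<psi> r)
      \<subseteq> kin_ball (C * r) \<and>
    (\<forall>s y w.
      \<bar>ker \<psi> r (s, y, w)\<bar> + norm (ker_pi \<psi> r (s, y, w)) + norm (ker_vec \<psi> r (s, y, w))
        \<le> C * r powi (- kinQ TYPE('d)) \<and>
      \<bar>ker_tilde \<psi> r (s, y, w)\<bar> \<le> C * r powi (- kinQ TYPE('d) + 1) \<and>
      (\<lambda>y. ker \<psi> r (s, y, w)) differentiable (at y) \<and>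
      (\<lambda>y. ker_pi \<psi> r (s, y, w)) differentiable (at y) \<and>
      (\<lambda>y. ker_vec \<psi> r (s, y, w)) differentiable (at y) \<and>
      (\<lambda>y. ker_tilde \<psi> r (s, y, w)) differentiable (at y) \<and>
      norm (grad (\<lambda>y. ker \<psi> r (s, y, w)) y) + norm (grad (\<lambda>y. ker_pi \<psi> r (s, y, w)) y)
          + norm (grad (\<lambda>y. ker_vec \<psi> r (s, y, w)) y)
        \<le> C * r powi (- kinQ TYPE('d) - 3) \<and>
      norm (grad (\<lambda>y. ker_tilde \<psi> r (s, y, w)) y) \<le> C * r powi (- kinQ TYPE('d) - 2))"
proof -
  let ?K = "supp \<psi>"
  have P0: "C1_supported_in ?K \<psi>" and P3: "C1_supported_in ?K (grad_m1 \<psi>)"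
    and P4: "C1_supported_in ?K (grad_m2 \<psi>)"
    using assms(1) by (rule smooth_C1 smooth_grad_C1)+
  have P1: "C1_supported_in ?K (\<lambda>x. \<psi> x *\<^sub>R fst (snd x))"
    and P2: "C1_supported_in ?K (\<lambda>x. \<psi> x *\<^sub>R snd (snd x))"
    by (intro C1_supported_scaleR_linear[OF P0] bounded_linear_compose[OF bounded_linear_fst]
          bounded_linear_compose[OF bounded_linear_snd] bounded_linear_snd)+
  have vec: "\<exists>B\<ge>0. C1_bound 1 B \<Phi>" if "C1_supported_in ?K \<Phi>"
    for \<Phi> :: "real \<times> (real^'d) \<times> (real^'d) \<Rightarrow> real^'d"
    using assms(2) that by (rule C1_supported_bounded)
  obtain B0 where B0: "B0 \<ge> 0" "C1_bound 1 B0 \<psi>"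
    using C1_supported_bounded[OF assms(2) P0] by blast
  obtain B1 where B1: "B1 \<ge> 0" "C1_bound 1 B1 (\<lambda>x. \<psi> x *\<^sub>R fst (snd x))"
    using vec[OF P1] by blast
  obtain B2 where B2: "B2 \<ge> 0" "C1_bound 1 B2 (\<lambda>x. \<psi> x *\<^sub>R snd (snd x))"
    using vec[OF P2] by blast
  obtain B3 where B3: "B3 \<ge> 0" "C1_bound 1 B3 (grad_m1 \<psi>)"
    using vec[OF P3] by blast
  obtain B4 where B4: "B4 \<ge> 0" "C1_bound 1 B4 (grad_m2 \<psi>)"
    using vec[OF P4] by blast
  define B where "B = B0 + B1 + B2 + B3 + B4"
  have B: "B0 \<le> B" "B1 \<le> B" "B2 \<le> B" "B3 \<le> B" "B4 \<le> B" "B \<ge> 0"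
    using B0(1) B1(1) B2(1) B3(1) B4(1) by (simp_all add: B_def)
  define n where "n = real CARD('d)"
  have "n \<ge> 1"
    by (simp add: n_def Suc_leI)
  define X where "X = 2 ^ CARD('d) * B"
  have "X \<ge> 0" using B(6) by (simp add: X_def)
  \<comment> \<open>The supports need \<open>5\<close>, the three kernels of the same order add up to \<open>8 + 48 + 256 = 312\<close>,
    and \<open>n\<close> accounts for the \<open>d\<close> partial derivatives.\<close>
  define C where "C = 5 + 312 * n * X"
  have nX: "X \<le> n * X" using \<open>n \<ge> 1\<close> \<open>X \<ge> 0\<close> by (simp add: mult_right_mono[of 1 n X, simplified])
  have C: "C \<ge> 5" "312 * X \<le> C" "32 * X \<le> C" "n * (312 * X) \<le> C" "n * (32 * X) \<le> C"
    using nX \<open>X \<ge> 0\<close> unfolding C_def mult.left_commute[of n] mult.assoc by linarith+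
  show ?thesis
  proof (intro exI[of _ C] conjI allI impI)
    show "C > 0" using C(1) by simp
    fix r :: real
    assume "r > 0"
    show "supp (ker \<psi> r) \<union> supp (ker_tilde \<psi> r) \<union> supp (ker_pi \<psi> r) \<union> supp (ker_vec \<psi> r)
      \<subseteq> kin_ball (C * r)"
      by (rule kernel_supports[OF assms(1,5) \<open>r > 0\<close> C(1)])
    fix s :: real and y w :: "real^'d"
    define q where "q = r powi (- kinQ TYPE('d))"
    have "q > 0" using \<open>r > 0\<close> by (simp add: q_def)
    have qp: "r powi (- kinQ TYPE('d) + 1) = q * r" "r powi (- kinQ TYPE('d) - 3) = q * (1 / r ^ 3)"
      "r powi (- kinQ TYPE('d) - 2) = q * r * (1 / r ^ 3)"
      using \<open>r > 0\<close> power_int_add[of r "- kinQ TYPE('d)" 1]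
      by (simp_all add: q_def power_int_diff field_simps power2_eq_square power3_eq_cube)
    note S = kernel_slice_bounds[OF B(6) \<open>r > 0\<close> C1_bound_mono[OF B0(2) B(1) zero_le_one]
        C1_bound_mono[OF B1(2) B(2) zero_le_one] C1_bound_mono[OF B2(2) B(3) zero_le_one]
        C1_bound_mono[OF B3(2) B(4) zero_le_one] C1_bound_mono[OF B4(2) B(5) zero_le_one] q_def,
        where s = s and w = w]
    note I1 = C1_bound_imp_grad[OF S(1), of y, folded n_def]
      and I2 = C1_bound_imp_grad[OF S(2), of y, folded n_def]
      and I3 = C1_bound_imp_grad[OF S(3), of y, folded n_def]
      and I4 = C1_bound_imp_grad[OF S(4), of y, folded n_def]
    let ?t = "1 / r ^ 3"
    have t: "?t > 0" using \<open>r > 0\<close> by simp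
    show "(\<lambda>y. ker \<psi> r (s, y, w)) differentiable (at y)"
      "(\<lambda>y. ker_pi \<psi> r (s, y, w)) differentiable (at y)"
      "(\<lambda>y. ker_vec \<psi> r (s, y, w)) differentiable (at y)"
      "(\<lambda>y. ker_tilde \<psi> r (s, y, w)) differentiable (at y)"
      by (fact I1(2) I2(2) I3(2) I4(2))+
    have "\<bar>ker \<psi> r (s, y, w)\<bar> + norm (ker_pi \<psi> r (s, y, w)) + norm (ker_vec \<psi> r (s, y, w))
        \<le> 312 * X * q"
      using I1(1) I2(1) I3(1) by (simp add: X_def mult_ac)
    also have "\<dots> \<le> C * q"
      using C(2) \<open>q > 0\<close> by (intro mult_right_mono) auto
    finally show "\<bar>ker \<psi> r (s, y, w)\<bar> + norm (ker_pi \<psi> r (s, y, w)) + norm (ker_vec \<psi> r (s, y, w))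
        \<le> C * r powi (- kinQ TYPE('d))"
      by (simp only: q_def)
    have "\<bar>ker_tilde \<psi> r (s, y, w)\<bar> \<le> 32 * X * (q * r)"
      using I4(1) by (simp add: X_def mult_ac)
    also have "\<dots> \<le> C * (q * r)"
      using C(3) \<open>q > 0\<close> \<open>r > 0\<close> by (intro mult_right_mono) auto
    finally show "\<bar>ker_tilde \<psi> r (s, y, w)\<bar> \<le> C * r powi (- kinQ TYPE('d) + 1)"
      by (simp only: qp)
    have "norm (grad (\<lambda>y. ker \<psi> r (s, y, w)) y) + norm (grad (\<lambda>y. ker_pi \<psi> r (s, y, w)) y)
          + norm (grad (\<lambda>y. ker_vec \<psi> r (s, y, w)) y)
        \<le> n * (2 ^ CARD('d) * q * (8 * B) * ?t) + n * (2 ^ CARD('d) * q * (256 * B) * ?t)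
          + n * (2 ^ CARD('d) * q * (48 * B) * ?t)"
      by (intro add_mono I1(3) I2(3) I3(3))
    also have "\<dots> = n * (312 * X) * (q * ?t)"
      by (simp add: X_def algebra_simps)
    also have "\<dots> \<le> C * (q * ?t)"
      using C(4) \<open>q > 0\<close> t by (intro mult_right_mono) auto
    finally show "norm (grad (\<lambda>y. ker \<psi> r (s, y, w)) y) + norm (grad (\<lambda>y. ker_pi \<psi> r (s, y, w)) y)
          + norm (grad (\<lambda>y. ker_vec \<psi> r (s, y, w)) y) \<le> C * r powi (- kinQ TYPE('d) - 3)"
      by (simp only: qp)
    have "norm (grad (\<lambda>y. ker_tilde \<psi> r (s, y, w)) y) \<le> n * (2 ^ CARD('d) * (q * r) * (32 * B) * ?t)"
      by (rule I4(3))
    also have "\<dots> = n * (32 * X) * (q * r * ?t)"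
      by (simp add: X_def mult_ac)
    also have "\<dots> \<le> C * (q * r * ?t)"
      using C(5) \<open>q > 0\<close> \<open>r > 0\<close> t by (intro mult_right_mono) auto
    finally show "norm (grad (\<lambda>y. ker_tilde \<psi> r (s, y, w)) y) \<le> C * r powi (- kinQ TYPE('d) - 2)"
      by (simp only: qp)
  qed
qed

end
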